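(* Let $D$ be the derivation on Laurent polynomials in the commuting variables $u,v,z$ determined by $D(z)=vz^2$, $D(v)=uv^2z$, $D(u)=u^2vz$ (extended by linearity and the Leibniz rule), and for such $f$ let $\mathrm{Gen}(f,t)=\sum_{n\ge0}D^n(f)\frac{t^n}{n!}$, a formal power series in $t$. Then $$\mathrm{Gen}(z,t)=z\exp\Big(\big(z^{-1}-u^{-1}z^{-1}+u^{-1}vt\big)\mathrm{Gen}(z,t)+u^{-1}-1\Big).$$
   Context: The exponential is taken in the sense of formal power series in $t$; the exponent has zero constant term in $t$. *)

theory Defs
  imports
    "HOL-Library.Poly_Mapping"
    "HOL-Library.Product_Plus"
    "HOL-Computational_Algebra.Formal_Power_Series"
begin

text \<open>
  Laurent polynomials in three commuting variables \<open>u\<close>, \<open>v\<close>, \<open>z\<close> over \<open>'k\<close>, as the group algebra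
  of \<open>\<int>\<^sup>3\<close>: finitely supported coefficient functions on exponent triples, in the order \<open>u\<close>, \<open>v\<close>,
  \<open>z\<close>. The product of \<open>Poly_Mapping\<close> is convolution, so this is the usual commutative ring.
\<close>

type_synonym 'k laurent = "int \<times> int \<times> int \<Rightarrow>\<^sub>0 'k"

definition lconst :: "'k \<Rightarrow> 'k::field_char_0 laurent"
  where "lconst c = Poly_Mapping.single 0 c"

definition lmon :: "int \<Rightarrow> int \<Rightarrow> int \<Rightarrow> 'k::field_char_0 laurent"
  where "lmon a b c = Poly_Mapping.single (a, b, c) 1"

definition lu :: "'k::field_char_0 laurent" where "lu = lmon 1 0 0"
definition lv :: "'k::field_char_0 laurent" where "lv = lmon 0 1 0"
definition lz :: "'k::field_char_0 laurent" where "lz = lmon 0 0 1"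

definition lu_inv :: "'k::field_char_0 laurent" where "lu_inv = lmon (-1) 0 0"
definition lz_inv :: "'k::field_char_0 laurent" where "lz_inv = lmon 0 0 (-1)"

definition derivation :: "('k::field_char_0 laurent \<Rightarrow> 'k laurent) \<Rightarrow> bool"
  where "derivation D \<longleftrightarrow>
    (\<forall>f g. D (f + g) = D f + D g) \<and>
    (\<forall>c f. D (lconst c * f) = lconst c * D f) \<and>
    (\<forall>f g. D (f * g) = D f * g + f * D g)"

definition Gen :: "('k::field_char_0 laurent \<Rightarrow> 'k laurent) \<Rightarrow> 'k laurent \<Rightarrow> 'k laurent fps"
  where "Gen D f = Abs_fps (\<lambda>n. lconst (1 / fact n) * (D ^^ n) f)"

text \<open>
  \<open>\<Sum>\<^sub>n F\<^sup>n / n!\<close>, meaningful when \<open>F\<close> has zero constant term. The library's \<open>fps_exp\<close> needs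
  coefficients in a field, whereas Laurent polynomials only form a ring containing the rationals.
\<close>

definition lexp :: "'k::field_char_0 laurent fps \<Rightarrow> 'k laurent fps"
  where "lexp F = fps_compose (Abs_fps (\<lambda>n. lconst (1 / fact n))) F"

lemma lmon_mult: "lmon a b c * lmon a' b' c' = lmon (a + a') (b + b') (c + c')"
  by (simp add: lmon_def mult_single)

lemma lmon_0: "lmon 0 0 0 = 1"
  by (simp add: lmon_def flip: single_one zero_prod_def)

lemma lu_inv: "lu * lu_inv = 1" and lz_inv: "lz * lz_inv = 1"
  by (simp_all add: lu_def lu_inv_def lz_def lz_inv_def lmon_mult lmon_0)

lemma exponent_nth_0:
  fixes D :: "'k::field_char_0 laurent \<Rightarrow> 'k laurent"
  shows "fps_nth ((fps_const (lz_inv - lu_inv * lz_inv) + fps_const (lu_inv * lv) * fps_X) * Gen D lz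
      + fps_const (lu_inv - 1)) 0 = 0"
proof -
  have "fps_nth (Gen D lz) 0 = lz" by (simp add: Gen_def lconst_def)
  moreover have "(lz_inv - lu_inv * lz_inv) * lz = (1 - lu_inv :: 'k laurent)"
    by (simp add: left_diff_distrib mult.assoc mult.commute[of lz_inv] lz_inv)
  ultimately show ?thesis by simp
qed

text \<open>The prescribed values on the variables do determine a derivation, and only one.\<close>

lemma laurent_induct [case_names zero add]:
  fixes f :: "'k::field_char_0 laurent"
  assumes "P 0" and "\<And>f x a b c. P f \<Longrightarrow> P (f + lconst x * lmon a b c)"
  shows "P f"
proof (induction f rule: update_induct)
  case const
  then show ?case by (rule assms(1))
next
  case (update f k x)
  obtain a b c where k: "k = (a, b, c)" by (cases k)
  have "Poly_Mapping.update k x f = f + Poly_Mapping.single k x"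
    using update.hyps(1)
    by (intro poly_mapping_eqI) (auto simp: lookup_update lookup_add lookup_single in_keys_iff)
  also have "Poly_Mapping.single k x = lconst x * lmon a b c"
    by (simp add: k lconst_def lmon_def mult_single)
  finally show ?case using assms(2) update.IH by simp
qed

lemma derivation_unique:
  fixes D E :: "'k::field_char_0 laurent \<Rightarrow> 'k laurent"
  assumes D: "derivation D" and E: "derivation E"
    and u: "D lu = E lu" and v: "D lv = E lv" and z: "D lz = E lz"
  shows "D = E"
proof -
  have additive: "F (f + g) = F f + F g" and scale: "F (lconst c * f) = lconst c * F f"
    and leib: "F (f * g) = F f * g + f * F g" if "derivation F" for F :: "'k laurent \<Rightarrow> _" and f g c
    using that by (auto simp: derivation_def)
  have one: "F 1 = 0" if "derivation F" for F :: "'k laurent \<Rightarrow> _"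
    using leib[OF that, of 1 1] by simp
  have zero0: "F 0 = 0" if "derivation F" for F :: "'k laurent \<Rightarrow> _"
    using additive[OF that, of 0 0] by simp
  have mult: "D (f * g) = E (f * g)" if "D f = E f" "D g = E g" for f g
    using that leib[OF D] leib[OF E] by simp
  have inv: "D g = E g" if "f * g = 1" "D f = E f" for f g
  proof -
    have *: "F g = - (F f * g * g)" if F: "derivation F" for F :: "'k laurent \<Rightarrow> _"
    proof -
      have "F f * g + f * F g = 0" using leib[OF F, of f g] \<open>f * g = 1\<close> one[OF F] by simp
      moreover have "(F f * g + f * F g) * g = F f * g * g + (f * g) * F g"
        by (simp add: algebra_simps)
      ultimately have "F f * g * g + F g = 0" using \<open>f * g = 1\<close> by simp
      then show ?thesis by (simp add: eq_neg_iff_add_eq_0 add.commute)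
    qed
    show ?thesis using *[OF D] *[OF E] that(2) by simp
  qed
  have pow: "D (X a) = E (X a)"
    if X: "\<And>a b. X a * X b = X (a + b)" "X 0 = 1" "D (X 1) = E (X 1)" for X :: "int \<Rightarrow> _" and a
  proof (induction a rule: int_induct[where k = 0])
    case base
    then show ?case using X one[OF D] one[OF E] by simp
  next
    case (step1 i)
    then show ?case using mult[of "X i" "X 1"] X by simp
  next
    case (step2 i)
    have "D (X (-1)) = E (X (-1))" using inv[of "X 1" "X (-1)"] X by simp
    then show ?case using mult[of "X i" "X (-1)"] X(1)[of i "-1"] step2 by simp
  qed
  have mon: "D (lmon a b c) = E (lmon a b c)" for a b c
  proof -
    have "D (lmon a 0 0) = E (lmon a 0 0)"
      using pow[of "\<lambda>a. lmon a 0 0" a] u by (simp add: lmon_mult lmon_0 lu_def)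
    moreover have "D (lmon 0 b 0) = E (lmon 0 b 0)"
      using pow[of "\<lambda>a. lmon 0 a 0" b] v by (simp add: lmon_mult lmon_0 lv_def)
    moreover have "D (lmon 0 0 c) = E (lmon 0 0 c)"
      using pow[of "\<lambda>a. lmon 0 0 a" c] z by (simp add: lmon_mult lmon_0 lz_def)
    ultimately have "D (lmon a 0 0 * lmon 0 b 0 * lmon 0 0 c) = E (lmon a 0 0 * lmon 0 b 0 * lmon 0 0 c)"
      by (intro mult)
    then show ?thesis by (simp add: lmon_mult)
  qed
  have "D f = E f" for f
  proof (induction f rule: laurent_induct)
    case zero
    then show ?case using zero0[OF D] zero0[OF E] by simp
  next
    case (add f x a b c)
    then show ?case
      using additive[OF D] additive[OF E] scale[OF D] scale[OF E] mon by simp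
  qed
  then show ?thesis by blast
qed

lemma derivation_exists:
  "\<exists>D :: 'k::field_char_0 laurent \<Rightarrow> _. derivation D \<and>
     D lz = lv * lz ^ 2 \<and> D lv = lu * lv ^ 2 * lz \<and> D lu = lu ^ 2 * lv * lz"
proof -
  define W :: "(int \<times> int \<times> int \<Rightarrow> 'k) \<Rightarrow> 'k laurent \<Rightarrow> 'k laurent"
    where "W w = Poly_Mapping.mapp (\<lambda>k x. w k * x)" for w
  have lk: "Poly_Mapping.lookup (W w f) k = w k * Poly_Mapping.lookup f k" for w f k
    by (auto simp: W_def lookup_mapp when_def in_keys_iff)
  have W_add: "W w (f + g) = W w f + W w g" for w f g
    by (rule poly_mapping_eqI) (simp add: lk lookup_add distrib_left)
  have W_single: "W w (Poly_Mapping.single k x) = Poly_Mapping.single k (w k * x)" for w k x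
    by (rule poly_mapping_eqI) (simp add: lk lookup_single when_def)
  have W_0: "W w 0 = 0" for w
    by (rule poly_mapping_eqI) (simp add: lk)
  have W_mult: "W w (f * g) = W w f * g + f * W w g"
    if w: "\<And>k l. w (k + l) = w k + w l" for w f g
  proof (induction f rule: laurent_induct)
    case zero
    then show ?case by (simp add: W_0)
  next
    case (add f x a b c)
    let ?s = "Poly_Mapping.single (a, b, c) x"
    have "W w (?s * g) = W w ?s * g + ?s * W w g"
    proof (induction g rule: laurent_induct)
      case zero
      then show ?case by (simp add: W_0)
    next
      case (add g y a' b' c')
      have "lconst y * lmon a' b' c' = Poly_Mapping.single (a', b', c') y"
        by (simp add: lconst_def lmon_def mult_single)
      moreover have "W w (?s * Poly_Mapping.single (a', b', c') y) =
          W w ?s * Poly_Mapping.single (a', b', c') y + ?s * W w (Poly_Mapping.single (a', b', c') y)"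
        using w[of "(a, b, c)" "(a', b', c')"]
        by (simp add: W_single mult_single algebra_simps flip: single_add)
      ultimately show ?case using add by (simp add: W_add algebra_simps)
    qed
    moreover have "lconst x * lmon a b c = ?s"
      by (simp add: lconst_def lmon_def mult_single)
    ultimately show ?case using add by (simp add: W_add algebra_simps)
  qed
  define w1 :: "int \<times> int \<times> int \<Rightarrow> 'k" where "w1 = (\<lambda>(a, b, c). of_int (a + b))"
  define w2 :: "int \<times> int \<times> int \<Rightarrow> 'k" where "w2 = (\<lambda>(a, b, c). of_int c)"
  have w: "w1 (k + l) = w1 k + w1 l" "w2 (k + l) = w2 k + w2 l" for k l
    by (auto simp: w1_def w2_def split: prod.splits)
  define D where "D f = lmon 1 1 1 * W w1 f + lmon 0 1 1 * W w2 f" for f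
  have W_const: "W w (lconst c * f) = lconst c * W w f"
    if "\<And>k l. w (k + l) = w k + w l" for w c f
  proof -
    have "w 0 = 0" using that[of 0 0] by simp
    then show ?thesis using W_mult[OF that, of "lconst c" f] by (simp add: lconst_def W_single)
  qed
  have "D (f + g) = D f + D g" for f g
    by (simp add: D_def W_add distrib_left ac_simps)
  moreover have "D (lconst c * f) = lconst c * D f" for c f
    by (simp only: D_def W_const[OF w(1)] W_const[OF w(2)] distrib_left mult.left_commute)
  moreover have "D (f * g) = D f * g + f * D g" for f g
    by (simp add: D_def W_mult[OF w(1)] W_mult[OF w(2)] algebra_simps)
  ultimately have "derivation D" by (simp add: derivation_def)
  moreover have "D lz = lv * lz ^ 2" "D lv = lu * lv ^ 2 * lz" "D lu = lu ^ 2 * lv * lz"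
    by (simp_all add: D_def lu_def lv_def lz_def lmon_def W_single w1_def w2_def mult_single
        power2_eq_square)
  ultimately show ?thesis by blast
qed

end

theory Submission
  imports Defs
begin

text \<open>
  \<open>Gen D\<close> is multiplicative and turns \<open>D\<close> into the formal derivative in \<open>t\<close>. Since
  \<open>u\<^sup>-\<^sup>1 v\<close> is a constant of \<open>D\<close> and \<open>D (z\<^sup>-\<^sup>1 - u\<^sup>-\<^sup>1 z\<^sup>-\<^sup>1) = u\<^sup>-\<^sup>1 v\<close>, the cofactor of \<open>Gen D z\<close>
  in the exponent is \<open>Gen D (z\<^sup>-\<^sup>1 - u\<^sup>-\<^sup>1 z\<^sup>-\<^sup>1)\<close>, so the whole exponent \<open>F\<close> equals \<open>u\<^sup>-\<^sup>1 - Gen D u\<^sup>-\<^sup>1\<close>. As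
  \<open>D u\<^sup>-\<^sup>1 = - v z\<close>, both sides solve \<open>Y' = F' Y\<close> with initial value \<open>z\<close>.
\<close>

lemma lconst_simps [simp]: "lconst 0 = 0" "lconst 1 = 1"
  by (simp_all add: lconst_def)

lemma lconst_mult: "lconst (a * b) = lconst a * lconst b"
  by (simp add: lconst_def mult_single)

lemma lconst_of_nat: "lconst (of_nat n) = of_nat n"
  by (induction n) (simp_all add: lconst_def single_add)

lemma lconst_inverse_of_nat: "n > 0 \<Longrightarrow> lconst (1 / of_nat n) * (of_nat n * x) = x"
  unfolding lconst_of_nat[symmetric] mult.assoc[symmetric] lconst_mult[symmetric] by simp

lemma of_nat_Suc_mult_lconst_fact:
  "of_nat (Suc n) * lconst (1 / fact (Suc n)) = lconst (1 / fact n)"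
  unfolding lconst_of_nat[symmetric] lconst_mult[symmetric] by (simp del: of_nat_Suc)

lemma of_nat_mult_laurent_cancel:
  fixes x y :: "'k::field_char_0 laurent"
  assumes "of_nat (Suc n) * x = of_nat (Suc n) * y"
  shows "x = y"
  using lconst_inverse_of_nat[of "Suc n"] assms by (metis zero_less_Suc)

lemma fps_laurent_ode_unique:
  fixes Y Z :: "'k::field_char_0 laurent fps"
  assumes "fps_deriv Y = A * Y" "fps_deriv Z = A * Z" "fps_nth Y 0 = fps_nth Z 0"
  shows "Y = Z"
proof (rule fps_ext)
  fix n
  show "fps_nth Y n = fps_nth Z n"
  proof (induction n rule: less_induct)
    case (less n)
    show ?case
    proof (cases n)
      case 0
      then show ?thesis using assms(3) by simp
    next
      case (Suc m)
      have "of_nat (Suc m) * fps_nth Y (Suc m) = fps_nth (A * Y) m"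
        by (simp flip: assms(1))
      also have "\<dots> = fps_nth (A * Z) m"
        unfolding fps_mult_nth using less Suc by (intro sum.cong) auto
      also have "\<dots> = of_nat (Suc m) * fps_nth Z (Suc m)"
        by (simp flip: assms(2))
      finally show ?thesis
        unfolding Suc by (rule of_nat_mult_laurent_cancel)
    qed
  qed
qed

lemma fps_deriv_lexp:
  fixes F :: "'k::field_char_0 laurent fps"
  assumes F0: "fps_nth F 0 = 0"
  shows "fps_deriv (lexp F) = fps_deriv F * lexp F"
proof (rule fps_ext)
  fix k
  let ?c = "\<lambda>i. lconst (1 / fact i) :: 'k laurent"
  have lexp_nth: "fps_nth (lexp F) m = (\<Sum>i=0..k. ?c i * fps_nth (F ^ i) m)" if "m \<le> k" for m
    unfolding lexp_def fps_compose_nth fps_nth_Abs_fps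
    using startsby_zero_power_prefix[OF F0] that by (intro sum.mono_neutral_left) auto
  have "fps_nth (fps_deriv (lexp F)) k
      = (\<Sum>i=0..Suc k. ?c i * fps_nth (fps_deriv (F ^ i)) k)"
    by (simp add: lexp_def fps_compose_nth sum_distrib_left mult_ac del: sum.cl_ivl_Suc of_nat_Suc)
  also have "\<dots> = (\<Sum>i=0..k. ?c (Suc i) * fps_nth (fps_deriv (F ^ Suc i)) k)"
    by (subst sum.atLeast0_atMost_Suc_shift) (simp del: fps_deriv_nth power_Suc)
  also have "\<dots> = (\<Sum>i=0..k. ?c i * fps_nth (fps_deriv F * F ^ i) k)"
  proof (rule sum.cong)
    fix i
    have "fps_nth (fps_deriv (F ^ Suc i)) k = of_nat (Suc i) * fps_nth (fps_deriv F * F ^ i) k"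
      by (subst fps_deriv_power) (simp add: mult.assoc fps_mult_left_const_nth del: of_nat_Suc fps_deriv_nth)
    then show "?c (Suc i) * fps_nth (fps_deriv (F ^ Suc i)) k = ?c i * fps_nth (fps_deriv F * F ^ i) k"
      by (simp only: mult.assoc[symmetric] mult.commute[of "?c (Suc i)"] of_nat_Suc_mult_lconst_fact)
  qed simp
  also have "\<dots> = (\<Sum>j=0..k. fps_nth (fps_deriv F) j * (\<Sum>i=0..k. ?c i * fps_nth (F ^ i) (k - j)))"
    unfolding fps_mult_nth sum_distrib_left by (subst sum.swap) (simp add: mult_ac del: fps_deriv_nth)
  also have "\<dots> = fps_nth (fps_deriv F * lexp F) k"
    unfolding fps_mult_nth by (intro sum.cong) (simp_all add: lexp_nth del: fps_deriv_nth)
  finally show "fps_nth (fps_deriv (lexp F)) k = fps_nth (fps_deriv F * lexp F) k" .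
qed

lemma lexp_nth_0 [simp]: "fps_nth (lexp F) 0 = 1"
  by (simp add: lexp_def fps_compose_nth)

context
  fixes D :: "'k::field_char_0 laurent \<Rightarrow> 'k laurent"
  assumes D: "derivation D"
begin

lemma derivation_add: "D (f + g) = D f + D g"
  and derivation_lconst_mult: "D (lconst c * f) = lconst c * D f"
  and derivation_mult: "D (f * g) = D f * g + f * D g"
  using D by (auto simp: derivation_def)

lemma derivation_0: "D 0 = 0"
  using derivation_add[of 0 0] by simp

lemma derivation_1: "D 1 = 0"
  using derivation_mult[of 1 1] by simp

lemma derivation_diff: "D (f - g) = D f - D g"
  using derivation_add[of "f - g" g] by (simp add: algebra_simps)

lemma derivation_sum: "D (\<Sum>i\<in>A. f i) = (\<Sum>i\<in>A. D (f i))"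
  by (induction A rule: infinite_finite_induct) (simp_all add: derivation_0 derivation_add)

lemma derivation_inverse:
  assumes "f * g = 1"
  shows "D g = - (D f * g * g)"
proof -
  have "0 = (D f * g + f * D g) * g"
    using derivation_mult[of f g] assms derivation_1 by simp
  also have "\<dots> = D f * g * g + (f * g) * D g"
    by (simp add: algebra_simps)
  finally show ?thesis
    using assms by (simp add: eq_neg_iff_add_eq_0 add.commute)
qed

lemma Gen_nth_0 [simp]: "fps_nth (Gen D f) 0 = f"
  by (simp add: Gen_def)

lemma Gen_nth_Suc: "of_nat (Suc n) * fps_nth (Gen D f) (Suc n) = D (fps_nth (Gen D f) n)"
proof -
  have "of_nat (Suc n) * fps_nth (Gen D f) (Suc n)
      = (of_nat (Suc n) * lconst (1 / fact (Suc n))) * D ((D ^^ n) f)"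
    unfolding Gen_def fps_nth_Abs_fps mult.assoc by simp
  then show ?thesis
    unfolding of_nat_Suc_mult_lconst_fact by (simp add: Gen_def derivation_lconst_mult)
qed

lemma Gen_eqI:
  assumes "fps_nth G 0 = f"
    and "\<And>n. of_nat (Suc n) * fps_nth G (Suc n) = D (fps_nth G n)"
  shows "Gen D f = G"
proof (rule fps_ext)
  fix n
  show "fps_nth (Gen D f) n = fps_nth G n"
  proof (induction n)
    case 0
    then show ?case by (simp add: assms(1))
  next
    case (Suc n)
    then have "of_nat (Suc n) * fps_nth (Gen D f) (Suc n) = of_nat (Suc n) * fps_nth G (Suc n)"
      by (simp only: Gen_nth_Suc assms(2))
    then show ?case by (rule of_nat_mult_laurent_cancel)
  qed
qed

lemma fps_deriv_Gen_nth: "fps_nth (fps_deriv (Gen D f)) n = D (fps_nth (Gen D f) n)"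
  using Gen_nth_Suc[of n f] by simp

lemma Gen_derivation: "Gen D (D f) = fps_deriv (Gen D f)"
proof (rule Gen_eqI)
  show "fps_nth (fps_deriv (Gen D f)) 0 = D f"
    using Gen_nth_Suc[of 0 f] by simp
  fix n
  show "of_nat (Suc n) * fps_nth (fps_deriv (Gen D f)) (Suc n) = D (fps_nth (fps_deriv (Gen D f)) n)"
    unfolding fps_deriv_Gen_nth
    by (simp only: derivation_lconst_mult flip: Gen_nth_Suc lconst_of_nat)
qed

lemma Gen_mult: "Gen D (f * g) = Gen D f * Gen D g"
proof (rule Gen_eqI)
  show "fps_nth (Gen D f * Gen D g) 0 = f * g" by simp
  fix n
  have "of_nat (Suc n) * fps_nth (Gen D f * Gen D g) (Suc n)
      = fps_nth (Gen D f * fps_deriv (Gen D g) + fps_deriv (Gen D f) * Gen D g) n"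
    unfolding fps_deriv_mult[symmetric] fps_deriv_nth by simp
  also have "\<dots> = D (fps_nth (Gen D f * Gen D g) n)"
    unfolding fps_add_nth fps_mult_nth fps_deriv_Gen_nth derivation_sum derivation_mult
    by (simp add: sum.distrib add.commute)
  finally show "of_nat (Suc n) * fps_nth (Gen D f * Gen D g) (Suc n)
      = D (fps_nth (Gen D f * Gen D g) n)" .
qed

lemma Gen_diff: "Gen D (f - g) = Gen D f - Gen D g"
  by (rule Gen_eqI) (simp_all add: right_diff_distrib Gen_nth_Suc derivation_diff del: of_nat_Suc)

lemma Gen_uminus: "Gen D (- f) = - Gen D f"
  using Gen_diff[of 0 f] Gen_diff[of 0 0] by simp

lemma Gen_const: "D f = 0 \<Longrightarrow> Gen D f = fps_const f"
  by (rule Gen_eqI) (simp_all add: derivation_0)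

lemma Gen_linear:
  assumes "D (D f) = 0"
  shows "Gen D f = fps_const f + fps_const (D f) * fps_X"
proof (rule Gen_eqI)
  fix n
  show "of_nat (Suc n) * fps_nth (fps_const f + fps_const (D f) * fps_X) (Suc n)
      = D (fps_nth (fps_const f + fps_const (D f) * fps_X) n)"
    by (cases n) (simp_all add: assms derivation_0 del: of_nat_Suc, simp)
qed simp

end

theorem theorem3p1:
  fixes D :: "'k::field_char_0 laurent \<Rightarrow> 'k laurent"
  assumes "derivation D"
    and "D lz = lv * lz ^ 2"
    and "D lv = lu * lv ^ 2 * lz"
    and "D lu = lu ^ 2 * lv * lz"
  shows "Gen D lz = fps_const lz * lexp
    ((fps_const (lz_inv - lu_inv * lz_inv) + fps_const (lu_inv * lv) * fps_X) * Gen D lz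
      + fps_const (lu_inv - 1))"
proof -
  note D = assms(1)
  let ?W = "lz_inv - lu_inv * lz_inv :: 'k laurent"
  let ?F = "(fps_const ?W + fps_const (lu_inv * lv) * fps_X) * Gen D lz + fps_const (lu_inv - 1)"
  have D_lu_inv: "D lu_inv = - (lv * lz)"
    unfolding derivation_inverse[OF D lu_inv] assms(4)
    by (simp add: lu_def lv_def lz_def lu_inv_def lmon_mult power2_eq_square)
  have D_lz_inv: "D lz_inv = - lv"
    unfolding derivation_inverse[OF D lz_inv] assms(2)
    by (simp add: lv_def lz_def lz_inv_def lmon_mult power2_eq_square)
  have D_const: "D (lu_inv * lv) = 0"
    unfolding derivation_mult[OF D] D_lu_inv assms(3)
    by (simp add: lu_def lv_def lz_def lu_inv_def lmon_mult power2_eq_square)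
  have D_W: "D ?W = lu_inv * lv"
    unfolding derivation_diff[OF D] derivation_mult[OF D] D_lu_inv D_lz_inv
    by (simp add: lu_def lv_def lz_def lu_inv_def lz_inv_def lmon_mult)
  have W_lz: "?W * lz = 1 - lu_inv"
    by (simp add: left_diff_distrib lz_def lu_inv_def lz_inv_def lmon_mult lmon_0)
  have "(fps_const ?W + fps_const (lu_inv * lv) * fps_X) * Gen D lz = Gen D (?W * lz)"
    using Gen_linear[OF D, of ?W] by (simp add: Gen_mult[OF D] D_W D_const)
  also have "\<dots> = 1 - Gen D lu_inv"
    unfolding W_lz Gen_diff[OF D] by (simp add: Gen_const[OF D] derivation_1[OF D])
  finally have "?F = fps_const lu_inv - Gen D lu_inv"
    by (simp flip: fps_const_sub)
  then have deriv_F: "fps_deriv ?F = Gen D (lv * lz)"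
    by (simp add: D_lu_inv Gen_uminus[OF D] flip: Gen_derivation[OF D])
  show ?thesis
  proof (rule fps_laurent_ode_unique)
    show "fps_deriv (Gen D lz) = Gen D (lv * lz) * Gen D lz"
      by (simp add: assms(2) power2_eq_square mult.assoc flip: Gen_derivation[OF D] Gen_mult[OF D])
    show "fps_deriv (fps_const lz * lexp ?F) = Gen D (lv * lz) * (fps_const lz * lexp ?F)"
      unfolding fps_deriv_mult_const_left fps_deriv_lexp[OF exponent_nth_0] deriv_F
      by (rule mult.left_commute)
    show "fps_nth (Gen D lz) 0 = fps_nth (fps_const lz * lexp ?F) 0"
      unfolding fps_mult_nth_0 lexp_nth_0 Gen_nth_0[OF D] by simp
  qed
qed

end
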